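(* Let $k$ be a field, $d,e$ positive integers, $P(X,Z)\in k[X,Z]$ monic in $Z$ with $r:=\deg_Z P$, and $Q(X,Y,Z)\in k[X,Y,Z]$ monic in $Y$ with $s:=\deg_Y Q$. Let $$B=\frac{k[X,Y,Z,T]}{(X^{d}Y-P(X,Z),\;X^{e}T-Q(X,Y,Z))}$$ with $x,z$ the images of $X,Z$ in $B$. Suppose that one of the following holds: $r\ge 2$ and $s\ge 2$; or $r\ge 2$ and $s=1$; or $r=1$, $s\ge 2$ and $e\ge 2$. Let $\psi$ be a $k$-algebra endomorphism of $B$ satisfying (i) $\psi(k[x,z])=k[x,z]$ and (ii) $\psi(x)=\lambda x$ for some $\lambda\in k^*$. Then $\psi$ is an automorphism of the ring $B$.
   Context: $k^*=k\setminus\{0\}$. *)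

theory Defs
  imports
    "HOL-Algebra.QuotRing"
    "HOL-Algebra.Generated_Rings"
    "HOL-Algebra.Algebraic_Closure_Type"
    "HOL-Computational_Algebra.Polynomial"
begin

text \<open>
  Polynomial rings in several variables are iterated univariate ones, with the variables
  adjoined in the order X, Z, Y, T:
  \<^item> k[X,Z] = k[X][Z],
  \<^item> k[X,Y,Z] = k[X][Z][Y],
  \<^item> k[X,Y,Z,T] = k[X][Z][Y][T].

  So for an element of k[X,Z] the degree and leading coefficient of the library are those with
  respect to Z, and for an element of k[X,Y,Z] they are those with respect to Y.
\<close>

type_synonym 'k poly_XZ = "'k poly poly"
type_synonym 'k poly_XYZ = "'k poly poly poly"
type_synonym 'k poly_XYZT = "'k poly poly poly poly"

definition const4 :: "'k::field \<Rightarrow> 'k poly_XYZT"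
  where "const4 a = [:[:[:[:a:]:]:]:]"

definition X4 :: "'k::field poly_XYZT"
  where "X4 = [:[:[:[:0, 1:]:]:]:]"

definition Z4 :: "'k::field poly_XYZT"
  where "Z4 = [:[:[:0, 1:]:]:]"

definition Y4 :: "'k::field poly_XYZT"
  where "Y4 = [:[:0, 1:]:]"

definition T4 :: "'k::field poly_XYZT"
  where "T4 = [:0, 1:]"

definition emb_XZ :: "'k::field poly_XZ \<Rightarrow> 'k poly_XYZT"
  where "emb_XZ P = [:[:P:]:]"

definition emb_XYZ :: "'k::field poly_XYZ \<Rightarrow> 'k poly_XYZT"
  where "emb_XYZ Q = [:Q:]"

definition ring_XYZT :: "'k::field poly_XYZT ring"
  where "ring_XYZT = ring_of_type_algebra"

definition B_ideal :: "nat \<Rightarrow> nat \<Rightarrow> 'k::field poly_XZ \<Rightarrow> 'k poly_XYZ \<Rightarrow> 'k poly_XYZT set"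
  where "B_ideal d e P Q =
    Idl\<^bsub>ring_XYZT\<^esub> {X4 ^ d * Y4 - emb_XZ P, X4 ^ e * T4 - emb_XYZ Q}"

definition B_ring :: "nat \<Rightarrow> nat \<Rightarrow> 'k::field poly_XZ \<Rightarrow> 'k poly_XYZ \<Rightarrow> 'k poly_XYZT set ring"
  where "B_ring d e P Q = ring_XYZT Quot (B_ideal d e P Q)"

definition B_class ::
    "nat \<Rightarrow> nat \<Rightarrow> 'k::field poly_XZ \<Rightarrow> 'k poly_XYZ \<Rightarrow> 'k poly_XYZT \<Rightarrow> 'k poly_XYZT set"
  where "B_class d e P Q f = B_ideal d e P Q +>\<^bsub>ring_XYZT\<^esub> f"

definition B_const ::
    "nat \<Rightarrow> nat \<Rightarrow> 'k::field poly_XZ \<Rightarrow> 'k poly_XYZ \<Rightarrow> 'k \<Rightarrow> 'k poly_XYZT set"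
  where "B_const d e P Q a = B_class d e P Q (const4 a)"

definition B_x :: "nat \<Rightarrow> nat \<Rightarrow> 'k::field poly_XZ \<Rightarrow> 'k poly_XYZ \<Rightarrow> 'k poly_XYZT set"
  where "B_x d e P Q = B_class d e P Q X4"

definition B_z :: "nat \<Rightarrow> nat \<Rightarrow> 'k::field poly_XZ \<Rightarrow> 'k poly_XYZ \<Rightarrow> 'k poly_XYZT set"
  where "B_z d e P Q = B_class d e P Q Z4"

text \<open>The k-subalgebra k[x,z]: the subring generated by x, z and the image of k.\<close>

definition B_kxz :: "nat \<Rightarrow> nat \<Rightarrow> 'k::field poly_XZ \<Rightarrow> 'k poly_XYZ \<Rightarrow> 'k poly_XYZT set set"
  where "B_kxz d e P Q =
    generate_ring (B_ring d e P Q) (range (B_const d e P Q) \<union> {B_x d e P Q, B_z d e P Q})"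

definition B_alg_endo ::
    "nat \<Rightarrow> nat \<Rightarrow> 'k::field poly_XZ \<Rightarrow> 'k poly_XYZ
      \<Rightarrow> ('k poly_XYZT set \<Rightarrow> 'k poly_XYZT set) \<Rightarrow> bool"
  where "B_alg_endo d e P Q \<psi> \<longleftrightarrow>
    \<psi> \<in> ring_hom (B_ring d e P Q) (B_ring d e P Q) \<and>
    (\<forall>a. \<psi> (B_const d e P Q a) = B_const d e P Q a)"

end

theory Submission
  imports Defs "HOL-Computational_Algebra.Polynomial_Factorial"
begin

text \<open>
  \<open>B\<close> embeds into the field of fractions of \<open>k[X, Z]\<close>, because \<open>x\<close> is a nonzerodivisor on \<open>B\<close>;
  this follows from \<open>P\<close> and \<open>Q\<close> being monic. Surjectivity of \<open>\<psi>\<close> on \<open>k[x, z]\<close> together with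
  \<open>\<psi> x = \<lambda>x\<close> forces \<open>\<psi> z = \<mu>z + f(x)\<close> with \<open>\<mu> \<in> k\<^sup>*\<close>, and injectivity of \<open>\<psi>\<close> follows since every
  element of \<open>B\<close> is carried into \<open>k[x, z]\<close> by a power of \<open>x\<close>.

  For surjectivity one uses \<open>x\<^sup>d B \<inter> k[x, z] = (x\<^sup>d, P)\<close> and \<open>x\<^sup>e B \<inter> k[x, y, z] = (x\<^sup>e, Q)\<close>. The
  first gives \<open>\<psi> P = \<mu>\<^sup>r P + x\<^sup>d a\<close>, so \<open>\<psi> y\<close> is a unit multiple of \<open>y\<close> plus an element of
  \<open>k[x, z]\<close>. The second gives \<open>\<psi> Q = vQ + x\<^sup>e u\<close>; comparing leading terms in \<open>y\<close> modulo \<open>x\<close> shows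
  that \<open>v\<close> is a unit modulo \<open>x\<close>, hence modulo \<open>x\<^sup>e\<close>, which puts \<open>t\<close> into the image.
\<close>

section \<open>Ring homomorphisms between class-based rings and their extension to
  polynomials\<close>

locale type_ring_hom =
  fixes h :: "'a::comm_ring_1 \<Rightarrow> 'b::comm_ring_1"
  assumes hom_one [simp]: "h 1 = 1"
    and hom_add [simp]: "h (a + b) = h a + h b"
    and hom_mult [simp]: "h (a * b) = h a * h b"
begin

lemma hom_zero [simp]: "h 0 = 0"
  using hom_add[of 0 0] by simp

lemma hom_uminus [simp]: "h (- a) = - h a"
  using hom_add[of a "- a"] by (simp add: eq_neg_iff_add_eq_0 add.commute)

lemma hom_diff [simp]: "h (a - b) = h a - h b"
  using hom_add[of a "- b"] by simp

lemma hom_power [simp]: "h (a ^ n) = h a ^ n"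
  by (induction n) auto

lemma hom_sum: "h (sum f A) = (\<Sum>i\<in>A. h (f i))"
  by (induction A rule: infinite_finite_induct) auto

lemma map_poly_hom: "type_ring_hom (map_poly h)"
proof
  show "map_poly h 1 = 1" by (simp add: map_poly_1)
qed (auto intro!: poly_eqI simp: coeff_map_poly coeff_mult hom_sum)

lemma poly_map_poly_hom: "type_ring_hom (\<lambda>p. poly (map_poly h p) c)"
proof -
  interpret m: type_ring_hom "map_poly h" by (rule map_poly_hom)
  show ?thesis by unfold_locales auto
qed

lemma pcompose_map_poly_hom: "type_ring_hom (\<lambda>p. pcompose (map_poly h p) q)"
proof -
  interpret m: type_ring_hom "map_poly h" by (rule map_poly_hom)
  show ?thesis by unfold_locales (auto simp: pcompose_add pcompose_mult pcompose_1)
qed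

end

lemma type_ring_hom_comp:
  assumes "type_ring_hom f" "type_ring_hom g"
  shows "type_ring_hom (\<lambda>x. f (g x))"
  using assms by (simp add: type_ring_hom_def)

lemma type_ring_hom_const_poly: "type_ring_hom (\<lambda>a::'a::comm_ring_1. [:a:])"
  by unfold_locales auto

lemma pCons_as_sum: "pCons a p = [:a:] + [:0, 1:] * (p :: 'a::comm_ring_1 poly)"
  by simp

lemma type_ring_hom_poly_eqI:
  fixes f g :: "'a::comm_ring_1 poly \<Rightarrow> 'b::comm_ring_1"
  assumes "type_ring_hom f" "type_ring_hom g"
    and "\<And>a. f [:a:] = g [:a:]" "f [:0, 1:] = g [:0, 1:]"
  shows "f p = g p"
proof -
  interpret f: type_ring_hom f by fact
  interpret g: type_ring_hom g by fact
  show ?thesis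
  proof (induction p)
    case (pCons a p)
    show ?case
      unfolding pCons_as_sum[of a p] f.hom_add g.hom_add f.hom_mult g.hom_mult
      by (simp add: assms pCons)
  qed simp
qed

section \<open>Ideals with two generators, and monic polynomials modulo them\<close>

text \<open>Explicit linear combinations make sense in any commutative ring, so one notion serves at
  every level of the tower of polynomial rings; \<open>y = 0\<close> gives principal ideals.\<close>

definition ideal2 :: "'a::comm_ring_1 \<Rightarrow> 'a \<Rightarrow> 'a set"
  where "ideal2 x y = {a * x + b * y | a b. True}"

lemma ideal2I: "p = a * x + b * y \<Longrightarrow> p \<in> ideal2 x y"
  by (auto simp: ideal2_def)

lemma ideal2E:
  assumes "p \<in> ideal2 x y"
  obtains a b where "p = a * x + b * y"
  using assms by (auto simp: ideal2_def)

lemma ideal2_zero: "0 \<in> ideal2 x y"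
  by (rule ideal2I[of _ 0 _ 0]) simp

lemma ideal2_gen: "x \<in> ideal2 x y" "y \<in> ideal2 x y"
  by (rule ideal2I[of _ 1 _ 0], simp) (rule ideal2I[of _ 0 _ 1], simp)

lemma ideal2_add:
  assumes "p \<in> ideal2 x y" "q \<in> ideal2 x y"
  shows "p + q \<in> ideal2 x y"
proof -
  obtain a b where "p = a * x + b * y" using assms(1) by (rule ideal2E)
  moreover obtain a' b' where "q = a' * x + b' * y" using assms(2) by (rule ideal2E)
  ultimately show ?thesis
    by (intro ideal2I[of _ "a + a'" _ "b + b'"]) (simp add: algebra_simps)
qed

lemma ideal2_mult:
  assumes "p \<in> ideal2 x y"
  shows "c * p \<in> ideal2 x y"
proof -
  obtain a b where "p = a * x + b * y" using assms(1) by (rule ideal2E)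
  then show ?thesis
    by (intro ideal2I[of _ "c * a" _ "c * b"]) (simp add: algebra_simps)
qed

lemma ideal2_uminus: "p \<in> ideal2 x y \<Longrightarrow> - p \<in> ideal2 x y"
  using ideal2_mult[of p x y "-1"] by simp

lemma ideal2_diff: "p \<in> ideal2 x y \<Longrightarrow> q \<in> ideal2 x y \<Longrightarrow> p - q \<in> ideal2 x y"
  using ideal2_add[of p x y "- q"] ideal2_uminus[of q x y] by simp

lemma ideal2_sum: "(\<And>i. i \<in> A \<Longrightarrow> f i \<in> ideal2 x y) \<Longrightarrow> sum f A \<in> ideal2 x y"
  by (induction A rule: infinite_finite_induct) (auto intro: ideal2_add ideal2_zero)

text \<open>Moves membership between levels of the polynomial tower. For the converse, the
  combinations found for the coefficients are assembled one power of the variable at a time.\<close>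

lemma ideal2_poly_iff:
  "p \<in> ideal2 [:x:] [:y:] \<longleftrightarrow> (\<forall>i. Polynomial.coeff p i \<in> ideal2 x y)"
proof
  assume "p \<in> ideal2 [:x:] [:y:]"
  then obtain a b where p: "p = a * [:x:] + b * [:y:]" by (rule ideal2E)
  show "\<forall>i. Polynomial.coeff p i \<in> ideal2 x y"
  proof
    fix i
    show "Polynomial.coeff p i \<in> ideal2 x y"
      by (rule ideal2I[of _ "Polynomial.coeff a i" _ "Polynomial.coeff b i"]) (simp add: p mult.commute)
  qed
next
  assume "\<forall>i. Polynomial.coeff p i \<in> ideal2 x y"
  then show "p \<in> ideal2 [:x:] [:y:]"
  proof (induction p)
    case 0
    then show ?case by (simp add: ideal2_zero)
  next
    case (pCons c p)
    have "Polynomial.coeff p i \<in> ideal2 x y" for i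
      using pCons.prems by (metis coeff_pCons_Suc)
    then have p: "p \<in> ideal2 [:x:] [:y:]" using pCons.IH by blast
    have "c \<in> ideal2 x y"
      using pCons.prems by (metis coeff_pCons_0)
    then obtain a b where "c = a * x + b * y" by (rule ideal2E)
    then have "[:c:] \<in> ideal2 [:x:] [:y:]"
      by (intro ideal2I[of _ "[:a:]" _ "[:b:]"]) simp
    then show ?case
      unfolding pCons_as_sum[of c p] by (intro ideal2_add ideal2_mult p)
  qed
qed

text \<open>Modulo \<open>(x, y)\<close> the monic \<open>f\<close> is a nonzerodivisor, and a
  nonzero multiple of it has degree at least that of \<open>f\<close>. As \<open>D\<close> has no
  terms from that degree on, its congruence with \<open>w * f\<close> forces both \<open>w\<close>
  and \<open>D\<close> to vanish modulo the ideal.\<close>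

lemma monic_mult_mod_ideal2:
  fixes f D w :: "'a::comm_ring_1 poly"
  assumes monic: "lead_coeff f = 1"
    and D: "\<And>i. i \<ge> Polynomial.degree f \<Longrightarrow> Polynomial.coeff D i = 0"
    and I: "D - w * f \<in> ideal2 [:x:] [:y:]"
  shows "w \<in> ideal2 [:x:] [:y:]" "D \<in> ideal2 [:x:] [:y:]"
proof -
  let ?s = "Polynomial.degree f" and ?c = Polynomial.coeff
  \<comment> \<open>Downward induction on the index \<open>n\<close>, organised by \<open>k\<close>:
    the coefficient of \<open>w\<close> at \<open>n\<close> is that of \<open>w * f\<close> at
    \<open>n + ?s\<close>, minus terms that vanish or contain a higher coefficient of
    \<open>w\<close>.\<close>
  have "?c w n \<in> ideal2 x y" if "Polynomial.degree w < n + k" for n k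
    using that
  proof (induction k arbitrary: n rule: less_induct)
    case (less k)
    show ?case
    proof (cases "Polynomial.degree w < n")
      case True
      then show ?thesis by (simp add: coeff_eq_0 ideal2_zero)
    next
      case False
      let ?g = "\<lambda>i. ?c w i * ?c f (n + ?s - i)"
      have "?c (w * f) (n + ?s) = (\<Sum>i\<le>n + ?s. ?g i)"
        by (simp add: coeff_mult)
      also have "\<dots> = ?g n + (\<Sum>i\<in>{..n + ?s} - {n}. ?g i)"
        by (rule sum.remove) auto
      also have "?g n = ?c w n" using monic by simp
      finally have eq: "?c w n = - ?c (D - w * f) (n + ?s) - (\<Sum>i\<in>{..n + ?s} - {n}. ?g i)"
        by (simp add: D)
      have "?g i \<in> ideal2 x y" if "i \<in> {..n + ?s} - {n}" for i
      proof (cases "i < n")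
        case True
        then show ?thesis by (simp add: coeff_eq_0 ideal2_zero)
      next
        case False
        with that have "i > n" by auto
        moreover have "k > 0" using less.prems \<open>\<not> Polynomial.degree w < n\<close> by simp
        ultimately have "?c w i \<in> ideal2 x y"
          using less.prems by (intro less.IH[of "k - 1"]) auto
        then show ?thesis by (subst mult.commute) (rule ideal2_mult)
      qed
      moreover have "?c (D - w * f) (n + ?s) \<in> ideal2 x y"
        using I unfolding ideal2_poly_iff by blast
      ultimately show ?thesis
        unfolding eq by (intro ideal2_diff ideal2_uminus ideal2_sum)
    qed
  qed
  from this[of _ "Suc (Polynomial.degree w)"] show w: "w \<in> ideal2 [:x:] [:y:]"
    unfolding ideal2_poly_iff by auto
  show "D \<in> ideal2 [:x:] [:y:]"
    using ideal2_add[OF I ideal2_mult[OF w, of f]] by (simp add: mult.commute)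
qed

text \<open>The degree survives \<open>g\<close> because the leading coefficient 1 is sent to 1; in
  a domain, substituting a linear polynomial then multiplies the leading coefficient by a power of
  \<open>u\<close>.\<close>

lemma lead_coeff_pcompose_linear:
  fixes p :: "'b::comm_ring_1 poly" and g :: "'b \<Rightarrow> 'a::idom"
  assumes "type_ring_hom g" and monic: "lead_coeff p = 1" and "u \<noteq> 0"
  shows "Polynomial.degree (pcompose (map_poly g p) [:c, u:]) = Polynomial.degree p"
    and "lead_coeff (pcompose (map_poly g p) [:c, u:]) = u ^ Polynomial.degree p"
proof -
  interpret g: type_ring_hom g by fact
  have "g (lead_coeff p) \<noteq> 0" using monic by simp
  then have deg: "Polynomial.degree (map_poly g p) = Polynomial.degree p"
    by (rule map_poly_degree_eq)
  then show "Polynomial.degree (pcompose (map_poly g p) [:c, u:]) = Polynomial.degree p"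
    using \<open>u \<noteq> 0\<close> by (simp add: degree_pcompose)
  show "lead_coeff (pcompose (map_poly g p) [:c, u:]) = u ^ Polynomial.degree p"
    using \<open>u \<noteq> 0\<close> monic by (subst lead_coeff_comp) (auto simp: deg coeff_map_poly)
qed

section \<open>Embeddings into the four-variable ring and induction over its generators\<close>

abbreviation X2 :: "'k::field poly_XZ"
  where "X2 \<equiv> [:[:0, 1:]:]"

lemma type_ring_hom_emb_XYZ: "type_ring_hom (emb_XYZ :: 'k::field poly_XYZ \<Rightarrow> 'k poly_XYZT)"
  unfolding emb_XYZ_def by (rule type_ring_hom_const_poly)

lemma type_ring_hom_emb_XZ: "type_ring_hom (emb_XZ :: 'k::field poly_XZ \<Rightarrow> 'k poly_XYZT)"
  unfolding emb_XZ_def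
  using type_ring_hom_comp[OF type_ring_hom_const_poly type_ring_hom_const_poly] .

lemma emb_XZ_X2: "emb_XZ X2 = X4"
  by (simp add: emb_XZ_def X4_def)

interpretation emb_XZ: type_ring_hom emb_XZ by (rule type_ring_hom_emb_XZ)
interpretation emb_XYZ: type_ring_hom emb_XYZ by (rule type_ring_hom_emb_XYZ)

text \<open>The predicate lives on the four-variable ring, so that this principle can serve inside
  the one that adjoins \<open>T\<close>, with its base case supplied by the one for
  \<open>k[X, Z]\<close>.\<close>

lemma poly_XYZ_induct [case_names XZ Y add mult]:
  assumes "\<And>r. S (emb_XZ r)" "S Y4"
    and add: "\<And>p q. S p \<Longrightarrow> S q \<Longrightarrow> S (p + q)"
    and mult: "\<And>p q. S p \<Longrightarrow> S q \<Longrightarrow> S (p * q)"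
  shows "S (emb_XYZ q)"
proof (induction q)
  case 0
  then show ?case using assms(1)[of 0] by simp
next
  case (pCons a q)
  have "emb_XYZ (pCons a q) = emb_XZ a + Y4 * emb_XYZ q"
    by (simp add: emb_XYZ_def emb_XZ_def Y4_def)
  then show ?case using assms pCons by auto
qed

lemma poly_XYZT_induct [case_names XZ Y T add mult]:
  assumes "\<And>r. S (emb_XZ r)" "S Y4" "S T4"
    and add: "\<And>p q. S p \<Longrightarrow> S q \<Longrightarrow> S (p + q)"
    and mult: "\<And>p q. S p \<Longrightarrow> S q \<Longrightarrow> S (p * q)"
  shows "S p"
proof -
  have 3: "S (emb_XYZ q)" for q
    using assms(1,2) add mult by (rule poly_XYZ_induct)
  show ?thesis
  proof (induction p)
    case 0
    then show ?case using assms(1)[of 0] by simp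
  next
    case (pCons a p)
    have "pCons a p = emb_XYZ a + T4 * p"
      by (simp add: emb_XYZ_def T4_def)
    then show ?case using assms pCons 3 by auto
  qed
qed

lemma poly_XZ_induct [case_names const X Z add mult]:
  assumes "\<And>c. S (const4 c)" "S X4" "S Z4"
    and add: "\<And>p q. S p \<Longrightarrow> S q \<Longrightarrow> S (p + q)"
    and mult: "\<And>p q. S p \<Longrightarrow> S q \<Longrightarrow> S (p * q)"
  shows "S (emb_XZ r)"
proof -
  have 0: "S 0" using assms(1)[of 0] by (simp add: const4_def)
  have 1: "S (emb_XZ [:c:])" for c
  proof (induction c)
    case 0
    then show ?case using \<open>S 0\<close> by simp
  next
    case (pCons a c)
    have "emb_XZ [:pCons a c:] = const4 a + X4 * emb_XZ [:c:]"
      by (simp add: emb_XZ_def const4_def X4_def)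
    then show ?case using assms pCons by auto
  qed
  show ?thesis
  proof (induction r)
    case 0
    then show ?case using \<open>S 0\<close> by simp
  next
    case (pCons a r)
    have "emb_XZ (pCons a r) = emb_XZ [:a:] + Z4 * emb_XZ r"
      by (simp add: emb_XZ_def Z4_def)
    then show ?case using assms pCons 1 by auto
  qed
qed

text \<open>\<open>X\<close> stays prime in the polynomial tower, and it cannot divide
  \<open>P\<close>, since it would then divide the leading coefficient 1.\<close>

lemma X4_dvd_mult_monic:
  fixes P :: "'k::field poly_XZ"
  assumes monic: "lead_coeff P = 1" and "X4 dvd p * emb_XZ P"
  shows "X4 dvd p"
proof -
  have "prime_elem ([:0, 1:] :: 'k poly)"
    by (rule prime_elem_linear_field_poly) simp
  then have "prime_elem (X4 :: 'k poly_XYZT)"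
    unfolding X4_def by (intro lift_prime_elem_poly)
  moreover have "\<not> X4 dvd emb_XZ P"
  proof
    assume "X4 dvd emb_XZ P"
    then have "[:[:0, 1:]:] dvd P"
      unfolding X4_def emb_XZ_def by (simp only: const_poly_dvd_const_poly_iff)
    then have "[:0, 1:] dvd lead_coeff P"
      unfolding const_poly_dvd_iff by blast
    then have "[:0, 1:] dvd (1 :: 'k poly)" using monic by simp
    then show False by (simp add: is_unit_poly_iff)
  qed
  ultimately show ?thesis
    using assms(2) prime_elem_dvd_mult_iff by blast
qed

section \<open>The defining ideal of \<open>B\<close>, and divisibility by powers of
  \<open>x\<close>\<close>

locale threefold =
  fixes d e :: nat and P :: "'k::field poly_XZ" and Q :: "'k poly_XYZ"
  assumes d_pos: "d \<ge> 1" and e_pos: "e \<ge> 1"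
    and monic_P: "lead_coeff P = 1" and monic_Q: "lead_coeff Q = 1"
    and degree_Q: "Polynomial.degree Q \<ge> 1"
begin

definition J :: "'k poly_XYZT set"
  where "J = ideal2 (X4 ^ d * Y4 - emb_XZ P) (X4 ^ e * T4 - emb_XYZ Q)"

text \<open>Put \<open>F = X^d Y - P\<close> and \<open>G = X^e T - Q\<close>. Modulo
  \<open>X\<close> they become \<open>-P\<close> and \<open>-Q\<close>, and \<open>P\<close>,
  \<open>Q\<close> form a regular sequence there, being monic in \<open>Z\<close> and in
  \<open>Y\<close>. Hence the coefficients of a relation \<open>a F + b G = 0\<close> modulo
  \<open>X\<close> are a multiple of \<open>(-Q, P)\<close>, up to multiples of
  \<open>X\<close>.\<close>

lemma mult_X4_memJ_imp:
  assumes "X4 * p \<in> J"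
  shows "p \<in> J"
proof -
  let ?P = "emb_XZ P" and ?Q = "emb_XYZ Q"
  obtain a b where ab: "X4 * p = a * (X4 ^ d * Y4 - ?P) + b * (X4 ^ e * T4 - ?Q)"
    using assms unfolding J_def by (rule ideal2E)
  obtain d' e' where de: "d = Suc d'" "e = Suc e'"
    using d_pos e_pos by (metis Suc_le_D One_nat_def)
  have "b * ?Q = (a * X4 ^ d' * Y4 + b * X4 ^ e' * T4 - p) * X4 + (- a) * ?P"
    using ab by (simp add: de algebra_simps)
  then have "b * ?Q \<in> ideal2 X4 ?P" by (rule ideal2I)
  then have bQ: "b * ?Q \<in> ideal2 [:[:X2:]:] [:[:P:]:]"
    unfolding X4_def emb_XZ_def .
  \<comment> \<open>\<open>Q\<close> is free of \<open>T\<close>, so the result on monic polynomials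
    applies to each \<open>T\<close>-coefficient of \<open>b\<close>, with
    \<open>D = 0\<close>.\<close>
  have "Polynomial.coeff b i \<in> ideal2 [:X2:] [:P:]" for i
  proof (rule monic_mult_mod_ideal2(1)[OF monic_Q, of 0])
    have "Polynomial.coeff (b * ?Q) i \<in> ideal2 [:X2:] [:P:]"
      using bQ unfolding ideal2_poly_iff[of "b * ?Q"] by blast
    from ideal2_uminus[OF this] show "0 - Polynomial.coeff b i * Q \<in> ideal2 [:X2:] [:P:]"
      by (simp add: emb_XYZ_def mult.commute)
  qed simp
  then have "b \<in> ideal2 X4 ?P"
    unfolding X4_def emb_XZ_def ideal2_poly_iff[of b] by blast
  then obtain u v where b: "b = u * X4 + v * ?P" by (rule ideal2E)
  have "(a + v * ?Q) * ?P = X4 * (a * X4 ^ d' * Y4 + b * X4 ^ e' * T4 - p - u * ?Q)"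
    using ab by (simp add: de b algebra_simps)
  then have "X4 dvd (a + v * ?Q) * ?P" by simp
  then have "X4 dvd a + v * ?Q" by (rule X4_dvd_mult_monic[OF monic_P])
  then obtain w where "a + v * ?Q = X4 * w" by blast
  then have a: "a = X4 * w - v * ?Q" by (simp add: algebra_simps)
  \<comment> \<open>The leftover \<open>v (P G - Q F)\<close> equals
    \<open>v (X^d Y G - X^e T F)\<close>, so a factor \<open>X\<close> comes out while
    \<open>F\<close> and \<open>G\<close> stay in place.\<close>
  have "X4 * p = X4 * (w * (X4 ^ d * Y4 - ?P) + u * (X4 ^ e * T4 - ?Q)
      + v * (X4 ^ d' * Y4 * (X4 ^ e * T4 - ?Q) - X4 ^ e' * T4 * (X4 ^ d * Y4 - ?P)))"
    unfolding ab a b by (simp add: de algebra_simps)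
  moreover have "X4 \<noteq> (0 :: 'k poly_XYZT)" by (simp add: X4_def)
  ultimately have "p = w * (X4 ^ d * Y4 - ?P) + u * (X4 ^ e * T4 - ?Q)
      + v * (X4 ^ d' * Y4 * (X4 ^ e * T4 - ?Q) - X4 ^ e' * T4 * (X4 ^ d * Y4 - ?P))"
    by (simp only: mult_cancel_left) simp
  then have "p = (w - v * X4 ^ e' * T4) * (X4 ^ d * Y4 - ?P)
      + (u + v * X4 ^ d' * Y4) * (X4 ^ e * T4 - ?Q)"
    by (simp add: algebra_simps)
  then show ?thesis unfolding J_def by (rule ideal2I)
qed

lemma power_X4_mult_memJ_imp: "X4 ^ n * p \<in> J \<Longrightarrow> p \<in> J"
  by (induction n) (auto simp: mult.assoc dest: mult_X4_memJ_imp)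

text \<open>The elements with this property are closed under sums and products. \<open>Y\<close> is
  among them since \<open>X^d Y\<close> is congruent to \<open>P\<close>; therefore so is
  \<open>Q\<close>, and then \<open>T\<close>, since \<open>X^e T\<close> is congruent to
  \<open>Q\<close>.\<close>

lemma ex_power_X4_mult_XZ: "\<exists>n r. X4 ^ n * p - emb_XZ r \<in> J"
proof -
  let ?S = "\<lambda>p. \<exists>n r. X4 ^ n * p - emb_XZ r \<in> J"
  have add: "?S (p + q)" and mult: "?S (p * q)" if p: "?S p" and q: "?S q" for p q
  proof -
    obtain n r where 1: "X4 ^ n * p - emb_XZ r \<in> J" using p by blast
    obtain m t where 2: "X4 ^ m * q - emb_XZ t \<in> J" using q by blast
    have "X4 ^ m * (X4 ^ n * p - emb_XZ r) + X4 ^ n * (X4 ^ m * q - emb_XZ t) \<in> J"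
      using 1 2 unfolding J_def by (intro ideal2_add ideal2_mult)
    then have "X4 ^ (n + m) * (p + q) - emb_XZ (X2 ^ m * r + X2 ^ n * t) \<in> J"
      unfolding emb_XZ.hom_add emb_XZ.hom_mult emb_XZ.hom_power emb_XZ_X2
      by (simp add: algebra_simps power_add)
    then show "?S (p + q)" by blast
    have "X4 ^ m * q * (X4 ^ n * p - emb_XZ r) + emb_XZ r * (X4 ^ m * q - emb_XZ t) \<in> J"
      using 1 2 unfolding J_def by (intro ideal2_add ideal2_mult)
    then have "X4 ^ (n + m) * (p * q) - emb_XZ (r * t) \<in> J"
      unfolding emb_XZ.hom_mult by (simp add: algebra_simps power_add)
    then show "?S (p * q)" by blast
  qed
  have XZ: "?S (emb_XZ r)" for r
    by (rule exI[of _ 0], rule exI[of _ r]) (simp add: J_def ideal2_zero)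
  have Y: "?S Y4"
    by (rule exI[of _ d], rule exI[of _ P]) (simp add: J_def ideal2_gen)
  have "?S (emb_XYZ Q)"
    using XZ Y add mult by (rule poly_XYZ_induct)
  then obtain n r where "X4 ^ n * emb_XYZ Q - emb_XZ r \<in> J" by blast
  then have "X4 ^ n * (X4 ^ e * T4 - emb_XYZ Q) + (X4 ^ n * emb_XYZ Q - emb_XZ r) \<in> J"
    unfolding J_def by (intro ideal2_add ideal2_mult ideal2_gen)
  then have "X4 ^ (n + e) * T4 - emb_XZ r \<in> J"
    by (simp add: algebra_simps power_add)
  then have T: "?S T4" by blast
  show ?thesis
    using XZ Y T add mult by (rule poly_XYZT_induct)
qed

text \<open>Setting \<open>T = 0\<close>, that is, taking the coefficient at 0, turns
  \<open>X^e T - Q\<close> into \<open>-Q\<close>. The result is a necessary condition for an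
  element of \<open>k[x, y, z]\<close> to be divisible by \<open>x^n\<close> in
  \<open>B\<close>.\<close>

lemma memJ_set_T_zero:
  assumes "emb_XYZ q - X4 ^ n * u \<in> J"
  obtains u' a b where
    "q = [:X2:] ^ n * u' + a * ([:X2 ^ d:] * [:0, 1:] - [:P:]) + b * Q"
proof -
  obtain a b where ab: "emb_XYZ q - X4 ^ n * u
      = a * (X4 ^ d * Y4 - emb_XZ P) + b * (X4 ^ e * T4 - emb_XYZ Q)"
    using assms unfolding J_def by (rule ideal2E)
  let ?c = "\<lambda>p. Polynomial.coeff p 0"
  have X: "?c (X4 ^ m) = [:X2:] ^ m" for m
    by (simp add: coeff_0_power X4_def)
  have Xd: "[:X2:] ^ d = [:X2 ^ d:]" by (simp add: poly_const_pow)
  have "?c (emb_XYZ q - X4 ^ n * u)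
      = ?c (a * (X4 ^ d * Y4 - emb_XZ P) + b * (X4 ^ e * T4 - emb_XYZ Q))"
    unfolding ab ..
  then have "q - [:X2:] ^ n * ?c u = ?c a * ([:X2 ^ d:] * [:0, 1:] - [:P:]) - ?c b * Q"
    by (simp only: coeff_diff coeff_add coeff_mult_0 X Xd)
      (simp add: emb_XYZ_def emb_XZ_def Y4_def T4_def)
  moreover have "p = A + B + (- C) * Q" if "p - A = B - C * Q" for p A B C :: "'k poly_XYZ"
    using that by (simp add: algebra_simps)
  ultimately have
    "q = [:X2:] ^ n * ?c u + ?c a * ([:X2 ^ d:] * [:0, 1:] - [:P:]) + (- ?c b) * Q"
    by blast
  then show thesis by (rule that)
qed

text \<open>Since \<open>Q\<close> is monic of positive degree in \<open>Y\<close>, the ring \<open>k[X, Z] / (X\<^sup>d, P)\<close> embeds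
  into \<open>B / x\<^sup>d B\<close>.\<close>
lemma XZ_mem_power_X4:
  assumes "emb_XZ p - X4 ^ d * u \<in> J"
  shows "p \<in> ideal2 (X2 ^ d) P"
proof -
  have "emb_XYZ [:p:] - X4 ^ d * u \<in> J"
    using assms by (simp add: emb_XZ_def emb_XYZ_def)
  then obtain u' a b where eq:
    "[:p:] = [:X2:] ^ d * u' + a * ([:X2 ^ d:] * [:0, 1:] - [:P:]) + b * Q"
    by (rule memJ_set_T_zero)
  have "[:p:] - b * Q = (u' + a * [:0, 1:]) * [:X2 ^ d:] + (- a) * [:P:]"
    unfolding eq poly_const_pow by (simp only: algebra_simps mult_minus_left) simp
  then have "[:p:] - b * Q \<in> ideal2 [:X2 ^ d:] [:P:]" by (rule ideal2I)
  then have "[:p:] \<in> ideal2 [:X2 ^ d:] [:P:]"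
    using degree_Q by (intro monic_mult_mod_ideal2(2)[OF monic_Q, of "[:p:]" b])
      (auto simp: coeff_pCons split: nat.split)
  then show ?thesis
    unfolding ideal2_poly_iff by (metis coeff_pCons_0)
qed

end

section \<open>Embedding of \<open>B\<close> into the field of fractions of
  \<open>k[X, Z]\<close>\<close>

lemma type_ring_hom_to_fract: "type_ring_hom to_fract"
  by unfold_locales auto

interpretation to_fract: type_ring_hom to_fract by (rule type_ring_hom_to_fract)

lemma to_fract_const_mult:
  "to_fract [:[:a:]:] * to_fract [:[:b:]:] = to_fract [:[:a * b :: 'k::field:]:]"
  unfolding to_fract.hom_mult[symmetric] by simp

lemma to_fract_const_power: "to_fract [:[:a:]:] ^ n = to_fract [:[:a ^ n :: 'k::field:]:]"
  unfolding to_fract.hom_power[symmetric] poly_const_pow ..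

lemma to_fract_const_one: "to_fract [:[:1 :: 'k::field:]:] = 1"
  by (simp flip: one_pCons)

context threefold
begin

text \<open>\<open>theta\<close> realises \<open>B\<close> as the subring \<open>k[X, Z, P / X\<^sup>d, Q / X\<^sup>e]\<close> of the field of
  fractions of \<open>k[X, Z]\<close>.\<close>

definition theta3 :: "'k poly_XYZ \<Rightarrow> 'k poly_XZ fract"
  where "theta3 q = poly (map_poly to_fract q) (to_fract P / to_fract X2 ^ d)"

definition theta :: "'k poly_XYZT \<Rightarrow> 'k poly_XZ fract"
  where "theta p = poly (map_poly theta3 p) (theta3 Q / to_fract X2 ^ e)"

lemma type_ring_hom_theta3: "type_ring_hom theta3"
  unfolding theta3_def by (rule to_fract.poly_map_poly_hom)

sublocale theta3: type_ring_hom theta3 by (rule type_ring_hom_theta3)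

lemma type_ring_hom_theta: "type_ring_hom theta"
  unfolding theta_def by (rule theta3.poly_map_poly_hom)

sublocale theta: type_ring_hom theta by (rule type_ring_hom_theta)

lemma theta3_const: "theta3 [:r:] = to_fract r"
  by (simp add: theta3_def map_poly_pCons)

lemma theta_emb_XYZ: "theta (emb_XYZ q) = theta3 q"
  by (simp add: theta_def emb_XYZ_def map_poly_pCons)

lemma theta_emb_XZ: "theta (emb_XZ r) = to_fract r"
  using theta_emb_XYZ[of "[:r:]"] by (simp add: theta3_const emb_XZ_def emb_XYZ_def)

lemma theta_X4: "theta X4 = to_fract X2"
  using theta_emb_XZ[of X2] by (simp only: emb_XZ_X2)

lemma theta_const4: "theta (const4 c) = to_fract [:[:c:]:]"
  using theta_emb_XZ[of "[:[:c:]:]"] by (simp add: emb_XZ_def const4_def)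

lemma to_fract_X2_nonzero: "to_fract (X2 :: 'k poly_XZ) \<noteq> 0"
  by simp

lemma theta_Y4: "to_fract X2 ^ d * theta Y4 = to_fract P"
  using to_fract_X2_nonzero by (simp add: theta_def theta3_def Y4_def map_poly_pCons)

lemma theta_T4: "to_fract X2 ^ e * theta T4 = theta3 Q"
  using to_fract_X2_nonzero by (simp add: theta_def T4_def map_poly_pCons)

text \<open>A power of \<open>X\<close> carries \<open>p\<close> to some \<open>r\<close> in
  \<open>k[X, Z]\<close>, where \<open>theta\<close> is injective; so \<open>r = 0\<close>, and the
  power of \<open>X\<close> can be cancelled modulo \<open>J\<close>.\<close>

lemma theta_eq_0_iff: "theta p = 0 \<longleftrightarrow> p \<in> J"
proof
  have J: "theta p = 0" if p: "p \<in> J" for p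
  proof -
    obtain a b where "p = a * (X4 ^ d * Y4 - emb_XZ P) + b * (X4 ^ e * T4 - emb_XYZ Q)"
      using p unfolding J_def by (rule ideal2E)
    then show ?thesis
      by (simp add: theta_X4 theta_Y4 theta_T4 theta_emb_XZ theta_emb_XYZ)
  qed
  then show "theta p = 0" if "p \<in> J" using that .
  assume 0: "theta p = 0"
  obtain n r where nr: "X4 ^ n * p - emb_XZ r \<in> J"
    using ex_power_X4_mult_XZ by blast
  from J[OF this] have "r = 0" by (simp add: 0 theta_emb_XZ)
  with nr show "p \<in> J" by (auto intro: power_X4_mult_memJ_imp)
qed

end

section \<open>The endomorphism seen in the field of fractions, and its injectivity\<close>

text \<open>\<open>omega\<close> stands for the endomorphism followed by \<open>theta\<close>, read
  on polynomial representatives; \<open>ker_theta\<close> says that it factors through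
  \<open>B\<close>. The two inclusions in \<open>\<psi>(k[x, z]) = k[x, z]\<close> enter as
  \<open>h\<close>, which represents the image of \<open>z\<close>, and \<open>p\<close>, which
  represents a preimage of \<open>z\<close>.\<close>

locale threefold_endo = threefold d e P Q + omega: type_ring_hom omega
  for d e :: nat and P :: "'k::field poly_XZ" and Q :: "'k poly_XYZ"
    and omega :: "'k poly_XYZT \<Rightarrow> 'k poly_XZ fract" +
  fixes lam :: 'k and h p :: "'k poly_XZ"
  assumes range_omega: "range omega \<subseteq> range theta"
    and ker_theta: "theta q = 0 \<Longrightarrow> omega q = 0"
    and omega_const4: "omega (const4 c) = theta (const4 c)"
    and omega_X4: "omega X4 = theta (const4 lam * X4)"
    and lam_nonzero: "lam \<noteq> 0"
    and omega_Z4: "omega Z4 = theta (emb_XZ h)"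
    and theta_Z4: "theta Z4 = omega (emb_XZ p)"
begin

definition scale :: "'k poly \<Rightarrow> 'k poly"
  where "scale c = pcompose c [:0, lam:]"

sublocale scale: type_ring_hom scale
  unfolding scale_def by unfold_locales (auto simp: pcompose_add pcompose_mult pcompose_1)

text \<open>The restriction of the endomorphism to \<open>k[x, z]\<close>, as the substitution of
  \<open>lam X\<close> for \<open>X\<close> and \<open>h\<close> for \<open>Z\<close>.\<close>

definition sigma :: "'k poly_XZ \<Rightarrow> 'k poly_XZ"
  where "sigma r = pcompose (map_poly scale r) h"

lemma type_ring_hom_sigma: "type_ring_hom sigma"
  unfolding sigma_def by (rule scale.pcompose_map_poly_hom)

sublocale sigma: type_ring_hom sigma by (rule type_ring_hom_sigma)

lemma omega_emb_XZ: "omega (emb_XZ r) = to_fract (sigma r)"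
proof (rule type_ring_hom_poly_eqI[where p = r])
  show hom: "type_ring_hom (\<lambda>r. omega (emb_XZ r))" "type_ring_hom (\<lambda>r. to_fract (sigma r))"
    by (rule type_ring_hom_comp[OF omega.type_ring_hom_axioms type_ring_hom_emb_XZ],
        rule type_ring_hom_comp[OF type_ring_hom_to_fract type_ring_hom_sigma])
  show "omega (emb_XZ [:0, 1:]) = to_fract (sigma [:0, 1:])"
    using omega_Z4 by (simp add: sigma_def map_poly_pCons pcompose_pCons Z4_def emb_XZ_def
        theta_emb_XZ[unfolded emb_XZ_def])
  show "omega (emb_XZ [:a:]) = to_fract (sigma [:a:])" for a
  proof (rule type_ring_hom_poly_eqI[where p = a])
    show "type_ring_hom (\<lambda>a. omega (emb_XZ [:a:]))" "type_ring_hom (\<lambda>a. to_fract (sigma [:a:]))"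
      using hom[THEN type_ring_hom_comp, OF type_ring_hom_const_poly] .
    show "omega (emb_XZ [:[:c:]:]) = to_fract (sigma [:[:c:]:])" for c
      using omega_const4[of c]
      by (simp add: emb_XZ_def const4_def theta_const4[unfolded const4_def] sigma_def map_poly_pCons
          scale_def)
    show "omega (emb_XZ [:[:0, 1:]:]) = to_fract (sigma [:[:0, 1:]:])"
    proof -
      have "omega (emb_XZ X2) = to_fract [:[:lam:]:] * to_fract X2"
        unfolding emb_XZ_X2 omega_X4 by (simp add: theta_X4 theta_const4)
      also have "\<dots> = to_fract ([:[:lam:]:] * X2)" by (simp only: to_fract.hom_mult)
      also have "[:[:lam:]:] * X2 = [:[:0, lam:]:]" by simp
      finally show ?thesis
        by (simp add: sigma_def map_poly_pCons scale_def pcompose_pCons)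
    qed
  qed
qed

lemma sigma_p: "sigma p = [:0, 1:]"
proof -
  have "theta Z4 = to_fract [:0, 1:]"
    using theta_emb_XZ[of "[:0, 1:]"] by (simp only: Z4_def emb_XZ_def)
  then have "to_fract (sigma p) = to_fract [:0, 1:]"
    unfolding omega_emb_XZ[symmetric] theta_Z4 .
  then show ?thesis by (simp only: to_fract_eq_iff)
qed

text \<open>Degrees in \<open>Z\<close> multiply under composition, so \<open>sigma p = Z\<close>
  forces degree 1; the leading coefficients multiply to 1, and the units of \<open>k[X]\<close> are
  the nonzero constants.\<close>

lemma h_linear: obtains f mu where "h = [:f, [:mu:]:]" "mu \<noteq> 0"
proof -
  let ?p = "map_poly scale p"
  have *: "pcompose ?p h = [:0, 1:]" using sigma_p by (simp add: sigma_def)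
  have "Polynomial.degree (pcompose ?p h) = 1" unfolding * by simp
  then have deg: "Polynomial.degree h = 1" "Polynomial.degree ?p = 1"
    by (simp_all add: degree_pcompose)
  have "lead_coeff (pcompose ?p h) = lead_coeff ?p * lead_coeff h ^ 1"
    using deg by (subst lead_coeff_comp) auto
  then have "lead_coeff ?p * lead_coeff h = 1" unfolding * by simp
  then have "lead_coeff h dvd 1" by (metis dvd_triv_right)
  then obtain mu where "lead_coeff h = [:mu:]" "mu dvd 1"
    by (auto simp: is_unit_poly_iff)
  moreover from this have "mu \<noteq> 0" by auto
  moreover have "h = [:Polynomial.coeff h 0, lead_coeff h:]"
    using deg by (intro poly_eqI) (auto simp: coeff_pCons coeff_eq_0 split: nat.split)
  ultimately show thesis using that by metis
qed

text \<open>Both substitutions are along polynomials of degree 1 over a domain: \<open>h\<close> in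
  \<open>Z\<close> and \<open>lam X\<close> in \<open>X\<close>.\<close>

lemma sigma_eq_0_imp:
  assumes "sigma r = 0"
  shows "r = 0"
proof -
  obtain f mu where h: "h = [:f, [:mu:]:]" "mu \<noteq> 0" by (rule h_linear)
  have "map_poly scale r = 0"
    using assms unfolding sigma_def by (rule pcompose_eq_0) (simp add: h)
  moreover have "c = 0" if "scale c = 0" for c
    using that unfolding scale_def by (rule pcompose_eq_0) (simp add: lam_nonzero)
  moreover have "scale (Polynomial.coeff r i) = Polynomial.coeff (map_poly scale r) i" for i
    by (simp add: coeff_map_poly)
  ultimately show ?thesis
    by (simp add: poly_eq_iff[of r])
qed

lemma omega_eq_0_imp:
  assumes "omega q = 0"
  shows "theta q = 0"
proof -
  obtain n r where "X4 ^ n * q - emb_XZ r \<in> J"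
    using ex_power_X4_mult_XZ by blast
  then have *: "theta (X4 ^ n * q - emb_XZ r) = 0" by (simp only: theta_eq_0_iff)
  have "omega (X4 ^ n * q - emb_XZ r) = 0" by (rule ker_theta[OF *])
  then have "to_fract (sigma r) = 0" by (simp add: assms omega_emb_XZ)
  then have "sigma r = 0" by (simp only: to_fract_eq_0_iff)
  then have "r = 0" by (rule sigma_eq_0_imp)
  with * show ?thesis by (simp add: theta_X4)
qed

text \<open>The relation \<open>x^d y = P\<close> makes \<open>sigma P\<close> divisible by
  \<open>x^d\<close> in \<open>B\<close>, hence a combination of \<open>X^d\<close> and
  \<open>P\<close>. Both \<open>sigma P\<close> and \<open>P\<close> have degree \<open>r\<close> in
  \<open>Z\<close>, with leading coefficients \<open>mu^r\<close> and 1, so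
  \<open>sigma P = mu^r P + a' X^d\<close>. Dividing by \<open>(lam x)^d\<close> gives
  \<open>nu = mu^r / lam^d\<close>.\<close>

lemma omega_Y4:
  obtains nu a where "nu \<noteq> 0" "omega Y4 = theta3 [:a, [:[:nu:]:]:]"
proof -
  let ?x = "to_fract (X2 :: 'k poly_XZ)" and ?K = "\<lambda>c::'k. to_fract [:[:c:]:]"
  let ?r = "Polynomial.degree P"
  obtain f mu where h: "h = [:f, [:mu:]:]" "mu \<noteq> 0" by (rule h_linear)
  obtain F where F: "omega Y4 = theta F" using range_omega by blast
  have "omega (X4 ^ d * Y4 - emb_XZ P) = 0"
    by (rule ker_theta) (simp add: theta_X4 theta_Y4 theta_emb_XZ)
  then have rel: "(?K lam * ?x) ^ d * omega Y4 = to_fract (sigma P)"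
    by (simp add: omega_X4 theta_X4 theta_const4 omega_emb_XZ)
  then have "theta (emb_XZ (sigma P) - X4 ^ d * (const4 lam ^ d * F)) = 0"
    by (simp add: theta_X4 theta_const4 theta_emb_XZ F power_mult_distrib mult_ac)
  then have "sigma P \<in> ideal2 (X2 ^ d) P"
    unfolding theta_eq_0_iff by (rule XZ_mem_power_X4)
  then obtain a b where ab: "sigma P = a * X2 ^ d + b * P" by (rule ideal2E)
  define u where "u = [:mu:] ^ ?r"
  have sigma_P: "sigma P = pcompose (map_poly scale P) [:f, [:mu:]:]"
    unfolding sigma_def h(1)[symmetric] ..
  have deg: "Polynomial.degree (sigma P) = ?r" "lead_coeff (sigma P) = u"
    unfolding sigma_P u_def
    using lead_coeff_pcompose_linear[OF scale.type_ring_hom_axioms monic_P, of "[:mu:]" f] h(2)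
    by auto
  \<comment> \<open>The second generator 0 makes this a congruence modulo \<open>X^d\<close> alone.
    The leading terms cancel, and what remains is congruent to a multiple of the monic
    \<open>P\<close>, so it vanishes modulo \<open>X^d\<close>.\<close>
  have "sigma P - [:u:] * P \<in> ideal2 [:[:0, 1:] ^ d:] [:0:]"
  proof (rule monic_mult_mod_ideal2(2)[OF monic_P])
    show "Polynomial.coeff (sigma P - [:u:] * P) i = 0" if "i \<ge> ?r" for i
      using that deg monic_P by (cases "i = ?r") (auto simp: coeff_eq_0)
    show "sigma P - [:u:] * P - (b - [:u:]) * P \<in> ideal2 [:[:0, 1:] ^ d:] [:0:]"
      unfolding ab poly_const_pow[symmetric] by (rule ideal2I[of _ a _ 0]) (simp add: algebra_simps)
  qed
  then obtain a' b' where "sigma P - [:u:] * P = a' * [:[:0, 1:] ^ d:] + b' * [:0:]"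
    by (rule ideal2E)
  then have "sigma P = [:[:mu ^ ?r:]:] * P + a' * X2 ^ d"
    by (simp add: u_def poly_const_pow algebra_simps)
  then have "?x ^ d * (?K lam ^ d * omega Y4) = ?K (mu ^ ?r) * to_fract P + to_fract a' * ?x ^ d"
    using rel by (simp only: to_fract.hom_add to_fract.hom_mult to_fract.hom_power
        power_mult_distrib mult_ac)
  also have "\<dots> = ?x ^ d * (?K (mu ^ ?r) * theta Y4 + to_fract a')"
    unfolding theta_Y4[symmetric] by (simp only: algebra_simps)
  finally have eq: "?K lam ^ d * omega Y4 = ?K (mu ^ ?r) * theta Y4 + to_fract a'"
    by simp
  define l where "l = inverse lam ^ d"
  have "l * lam ^ d = 1" using lam_nonzero by (simp add: l_def flip: power_mult_distrib)
  then have "?K l * ?K lam ^ d = 1"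
    by (simp only: to_fract_const_mult to_fract_const_power to_fract_const_one)
  then have "omega Y4 = ?K l * (?K lam ^ d * omega Y4)"
    by (simp only: mult.assoc[symmetric] mult_1_left)
  also have "\<dots> = ?K (l * mu ^ ?r) * theta Y4 + to_fract ([:[:l:]:] * a')"
    unfolding eq distrib_left mult.assoc[symmetric] to_fract_const_mult to_fract.hom_mult ..
  also have "\<dots> = theta3 [:[:[:l:]:] * a', [:[:l * mu ^ ?r:]:]:]"
    unfolding pCons_as_sum[of _ "[:[:[:l * mu ^ ?r:]:]:]"] theta3.hom_add theta3.hom_mult theta3_const
    using theta_emb_XYZ[of "[:0, 1:]"] by (simp add: emb_XYZ_def Y4_def mult.commute)
  finally show thesis
    using h(2) lam_nonzero by (intro that[of "l * mu ^ ?r"]) (auto simp: l_def)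
qed

section \<open>Surjectivity: the generators of \<open>B\<close> lie in the image\<close>

lemma const_in_range_omega: "to_fract [:[:c:]:] \<in> range omega"
  using omega_const4[of c] theta_const4[of c] by (metis rangeI)

lemma range_omega_add: "a \<in> range omega \<Longrightarrow> b \<in> range omega \<Longrightarrow> a + b \<in> range omega"
  by (elim rangeE) (simp flip: omega.hom_add)

lemma range_omega_diff: "a \<in> range omega \<Longrightarrow> b \<in> range omega \<Longrightarrow> a - b \<in> range omega"
  by (elim rangeE) (simp flip: omega.hom_diff)

lemma range_omega_mult: "a \<in> range omega \<Longrightarrow> b \<in> range omega \<Longrightarrow> a * b \<in> range omega"
  by (elim rangeE) (simp flip: omega.hom_mult)

lemma range_omega_power: "a \<in> range omega \<Longrightarrow> a ^ n \<in> range omega"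
  by (elim rangeE) (simp flip: omega.hom_power)

lemma const_mult_in_range_omega_imp:
  assumes "c \<noteq> 0" "to_fract [:[:c:]:] * a \<in> range omega"
  shows "a \<in> range omega"
proof -
  have "to_fract [:[:inverse c:]:] * to_fract [:[:c:]:] = 1"
    unfolding to_fract_const_mult left_inverse[OF assms(1)] by (rule to_fract_const_one)
  then have "a = to_fract [:[:inverse c:]:] * (to_fract [:[:c:]:] * a)"
    by (simp only: mult.assoc[symmetric] mult_1_left)
  also have "\<dots> \<in> range omega"
    by (intro range_omega_mult const_in_range_omega assms)
  finally show ?thesis .
qed

lemma to_fract_X2_in_range_omega: "to_fract X2 \<in> range omega"
proof (rule const_mult_in_range_omega_imp[OF lam_nonzero])
  show "to_fract [:[:lam:]:] * to_fract X2 \<in> range omega"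
    using omega_X4 by (metis rangeI theta.hom_mult theta_X4 theta_const4)
qed

lemma theta_emb_XZ_in_range_omega: "theta (emb_XZ r) \<in> range omega"
proof (rule poly_XZ_induct[where S = "\<lambda>p. theta p \<in> range omega"])
  show "theta (const4 c) \<in> range omega" for c
    unfolding theta_const4 by (rule const_in_range_omega)
  show "theta X4 \<in> range omega"
    unfolding theta_X4 by (rule to_fract_X2_in_range_omega)
  show "theta Z4 \<in> range omega"
    unfolding theta_Z4 by (rule rangeI)
qed (auto intro: range_omega_add range_omega_mult)

text \<open>The image of \<open>y\<close> is \<open>nu y + a\<close> with \<open>a\<close> in
  \<open>k[x, z]\<close>, which is already in the image, and \<open>nu\<close> is invertible; so
  \<open>y\<close> can be solved for.\<close>

lemma theta3_in_range_omega: "theta3 q \<in> range omega"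
  unfolding theta_emb_XYZ[symmetric]
proof (rule poly_XYZ_induct[where S = "\<lambda>p. theta p \<in> range omega"])
  show "theta (emb_XZ r) \<in> range omega" for r
    by (rule theta_emb_XZ_in_range_omega)
  obtain nu a where nu: "nu \<noteq> 0" "omega Y4 = theta3 [:a, [:[:nu:]:]:]" by (rule omega_Y4)
  have "theta3 [:0, 1:] = theta Y4"
    using theta_emb_XYZ[of "[:0, 1:]"] by (simp add: emb_XYZ_def Y4_def)
  with nu have "omega Y4 = to_fract a + theta Y4 * to_fract [:[:nu:]:]"
    unfolding pCons_as_sum[of a "[:[:[:nu:]:]:]"] theta3.hom_add theta3.hom_mult theta3_const by simp
  then have "to_fract [:[:nu:]:] * theta Y4 = omega Y4 - theta (emb_XZ a)"
    by (simp add: theta_emb_XZ mult.commute)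
  also have "\<dots> \<in> range omega"
    by (intro range_omega_diff rangeI theta_emb_XZ_in_range_omega)
  finally show "theta Y4 \<in> range omega"
    by (rule const_mult_in_range_omega_imp[OF nu(1)])
qed (auto intro: range_omega_add range_omega_mult)

text \<open>Modulo \<open>(X, P)\<close> both \<open>Q\<close> and its image are, up to units of \<open>k\<close>, monic of the same degree in
  \<open>Y\<close>, so the factor \<open>v\<close> relating them modulo \<open>x\<^sup>e\<close> is a unit plus a multiple of \<open>x\<close>. Hence it is
  invertible modulo \<open>x\<^sup>e\<close>.\<close>
lemma theta_T4_in_range_omega: "theta T4 \<in> range omega"
proof -
  let ?x = "to_fract (X2 :: 'k poly_XZ)" and ?K = "\<lambda>c::'k. to_fract [:[:c:]:]"
  let ?s = "Polynomial.degree Q"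
  obtain nu a where nu: "nu \<noteq> 0" "omega Y4 = theta3 [:a, [:[:nu:]:]:]" by (rule omega_Y4)
  \<comment> \<open>The lift of the endomorphism to \<open>k[X, Y, Z]\<close>: \<open>sigma\<close>
    acts on the coefficients and \<open>Y\<close> goes to \<open>nu Y + a\<close>.\<close>
  define tau where "tau q = pcompose (map_poly sigma q) [:a, [:[:nu:]:]:]" for q
  have hom_tau: "type_ring_hom tau"
    unfolding tau_def by (rule sigma.pcompose_map_poly_hom)
  have omega_emb_XYZ: "omega (emb_XYZ q) = theta3 (tau q)" for q
  proof (rule type_ring_hom_poly_eqI[where p = q])
    show "type_ring_hom (\<lambda>q. omega (emb_XYZ q))" "type_ring_hom (\<lambda>q. theta3 (tau q))"
      by (rule type_ring_hom_comp[OF omega.type_ring_hom_axioms type_ring_hom_emb_XYZ],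
          rule type_ring_hom_comp[OF type_ring_hom_theta3 hom_tau])
    show "omega (emb_XYZ [:r:]) = theta3 (tau [:r:])" for r
      using omega_emb_XZ[of r]
      by (simp add: emb_XYZ_def emb_XZ_def tau_def map_poly_pCons theta3_const)
    show "omega (emb_XYZ [:0, 1:]) = theta3 (tau [:0, 1:])"
      using nu(2) by (simp add: emb_XYZ_def Y4_def tau_def map_poly_pCons pcompose_pCons)
  qed
  obtain G where G: "omega T4 = theta G" using range_omega by blast
  have "omega (X4 ^ e * T4 - emb_XYZ Q) = 0"
    by (rule ker_theta) (simp add: theta_X4 theta_T4 theta_emb_XYZ)
  then have rel: "(?K lam * ?x) ^ e * omega T4 = theta3 (tau Q)"
    by (simp add: omega_X4 theta_X4 theta_const4 omega_emb_XYZ)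
  then have "theta (emb_XYZ (tau Q) - X4 ^ e * (const4 lam ^ e * G)) = 0"
    by (simp add: theta_X4 theta_const4 theta_emb_XYZ G power_mult_distrib mult_ac)
  then have "emb_XYZ (tau Q) - X4 ^ e * (const4 lam ^ e * G) \<in> J"
    unfolding theta_eq_0_iff .
  then obtain u b v where tau_Q:
    "tau Q = [:X2:] ^ e * u + b * ([:X2 ^ d:] * [:0, 1:] - [:P:]) + v * Q"
    by (rule memJ_set_T_zero)
  define c where "c = [:[:nu:]:] ^ ?s"
  have deg: "Polynomial.degree (tau Q) = ?s" "lead_coeff (tau Q) = c"
    unfolding tau_def c_def
    using lead_coeff_pcompose_linear[OF type_ring_hom_sigma monic_Q, of "[:[:nu:]:]" a] nu(1)
    by auto
  obtain d' e' where de: "d = Suc d'" "e = Suc e'"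
    using d_pos e_pos by (metis Suc_le_D One_nat_def)
  \<comment> \<open>Modulo \<open>(X, P)\<close> the equation for \<open>tau Q\<close> reduces to
    \<open>v Q\<close>, as \<open>d\<close> and \<open>e\<close> are positive. Subtracting
    \<open>c Q\<close> cancels the leading term in \<open>Y\<close>, so \<open>v\<close> must be
    congruent to \<open>c\<close>.\<close>
  have "v - [:c:] \<in> ideal2 [:X2:] [:P:]"
  proof (rule monic_mult_mod_ideal2(1)[OF monic_Q])
    show "Polynomial.coeff (tau Q - [:c:] * Q) i = 0" if "i \<ge> ?s" for i
      using that deg monic_Q by (cases "i = ?s") (auto simp: coeff_eq_0)
    have Xd: "[:X2 ^ d :: 'k poly_XZ:] = [:X2:] * [:X2:] ^ d'"
      unfolding de power_Suc poly_const_pow by simp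
    have "tau Q - [:c:] * Q - (v - [:c:]) * Q
        = ([:X2:] ^ e' * u + b * [:X2:] ^ d' * [:0, 1:]) * [:X2:] + (- b) * [:P:]"
      unfolding tau_Q Xd unfolding de power_Suc by (simp only: algebra_simps mult_minus_left) simp
    then show "tau Q - [:c:] * Q - (v - [:c:]) * Q \<in> ideal2 [:X2:] [:P:]"
      by (rule ideal2I)
  qed
  then obtain m n where "v - [:c:] = m * [:X2:] + n * [:P:]" by (rule ideal2E)
  then have "v = [:c:] + m * [:X2:] + n * [:P:]" by (simp only: algebra_simps)
  then have "theta3 v = to_fract c + theta3 m * ?x + theta3 n * (?x ^ d * theta Y4)"
    by (simp only: theta3.hom_add theta3.hom_mult theta3_const theta_Y4)
  also have "?x ^ d = ?x * ?x ^ d'" by (simp only: de power_Suc)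
  also have "to_fract c + theta3 m * ?x + theta3 n * (?x * ?x ^ d' * theta Y4)
      = to_fract c + ?x * (theta3 m + theta3 n * ?x ^ d' * theta Y4)"
    by (simp only: algebra_simps)
  finally have "theta3 v = to_fract c + ?x * (theta3 m + theta3 n * ?x ^ d' * theta Y4)" .
  \<comment> \<open>In \<open>B\<close> one has \<open>P = x^d y\<close>, so the summand with
    \<open>P\<close> is a multiple of \<open>x\<close> as well; \<open>W\<close> is the total
    cofactor of \<open>x\<close> in \<open>v - c\<close>.\<close>
  moreover define W where "W = theta3 (m + n * [:X2 ^ d':] * [:0, 1:])"
  moreover have Y: "theta3 [:0, 1:] = theta Y4"
    using theta_emb_XYZ[of "[:0, 1:]"] by (simp add: emb_XYZ_def Y4_def)
  ultimately have v: "theta3 v = to_fract c + ?x * W"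
    by (simp only: theta3.hom_add theta3.hom_mult theta3_const to_fract.hom_power)
  have "?x ^ e * (?K lam ^ e * omega T4) = theta3 (tau Q)"
    unfolding rel[symmetric] power_mult_distrib by (simp only: mult_ac)
  also have "\<dots> = ?x ^ e * theta3 u + theta3 b * (?x ^ d * theta Y4 - to_fract P) + theta3 v * theta3 Q"
    unfolding tau_Q by (simp only: theta3.hom_add theta3.hom_mult theta3.hom_diff theta3.hom_power
        theta3_const to_fract.hom_power Y)
  also have "\<dots> = ?x ^ e * theta3 u + theta3 v * (?x ^ e * theta T4)"
    unfolding theta_Y4 theta_T4 by (simp only: diff_self mult_zero_right add_0_right)
  also have "\<dots> = ?x ^ e * (theta3 u + theta3 v * theta T4)"
    by (simp only: algebra_simps)
  finally have "?x ^ e * (?K lam ^ e * omega T4) = ?x ^ e * (theta3 u + theta3 v * theta T4)" .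
  then have "?K lam ^ e * omega T4 = theta3 u + theta3 v * theta T4"
    using to_fract_X2_nonzero by (metis mult_left_cancel power_not_zero)
  then have "theta3 v * theta T4 = ?K lam ^ e * omega T4 - theta3 u" by simp
  also have "\<dots> \<in> range omega"
    by (intro range_omega_diff range_omega_mult range_omega_power const_in_range_omega
        theta3_in_range_omega rangeI)
  finally have base: "(to_fract c + ?x * W) * theta T4 \<in> range omega" unfolding v .
  have W: "W \<in> range omega" unfolding W_def by (rule theta3_in_range_omega)
  have c: "to_fract c = ?K (nu ^ ?s)" by (simp add: c_def poly_const_pow)
  \<comment> \<open>With \<open>w = -x W\<close>, the factor \<open>c - w\<close> divides
    \<open>c^n - w^n\<close>; the induction uses
    \<open>c^(n+1) - w^(n+1) = c^n (c - w) + w (c^n - w^n)\<close>.\<close>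
  have "(to_fract c ^ n - (?x * (- W)) ^ n) * theta T4 \<in> range omega" for n
  proof (induction n)
    case 0
    show ?case using const_in_range_omega[of 0] by simp
  next
    case (Suc n)
    have "(to_fract c ^ Suc n - (?x * (- W)) ^ Suc n) * theta T4
        = to_fract c ^ n * ((to_fract c + ?x * W) * theta T4)
          + (0 - ?x * W) * ((to_fract c ^ n - (?x * (- W)) ^ n) * theta T4)"
      by (simp add: algebra_simps)
    also have "\<dots> \<in> range omega"
      using const_in_range_omega[of 0]
      by (intro range_omega_add range_omega_mult range_omega_diff range_omega_power Suc base W
          to_fract_X2_in_range_omega) (auto simp: c const_in_range_omega)
    finally show ?case .
  qed
  then have "(to_fract c ^ e - (?x * (- W)) ^ e) * theta T4 \<in> range omega" .
  \<comment> \<open>The error term \<open>(-x W)^e t\<close> equals \<open>(-W)^e Q\<close> because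
    \<open>x^e t = Q\<close>, so it lies in the image; adding it back leaves the unit multiple
    \<open>c^e t\<close>.\<close>
  moreover have "(0 - W) ^ e * theta3 Q \<in> range omega"
    using const_in_range_omega[of 0]
    by (intro range_omega_mult range_omega_power range_omega_diff W theta3_in_range_omega) auto
  ultimately have "(to_fract c ^ e - (?x * (- W)) ^ e) * theta T4 + (0 - W) ^ e * theta3 Q \<in> range omega"
    by (rule range_omega_add)
  moreover have "(to_fract c ^ e - (?x * (- W)) ^ e) * theta T4 + (0 - W) ^ e * theta3 Q
      = to_fract c ^ e * theta T4"
    unfolding theta_T4[symmetric] power_mult_distrib by (simp add: algebra_simps)
  moreover have "to_fract c ^ e = ?K ((nu ^ ?s) ^ e)"
    unfolding c to_fract_const_power ..
  ultimately have "?K ((nu ^ ?s) ^ e) * theta T4 \<in> range omega" by simp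
  then show ?thesis
    by (rule const_mult_in_range_omega_imp[rotated]) (simp add: nu(1))
qed

lemma range_omega_eq: "range omega = range theta"
proof -
  have "theta q \<in> range omega" for q
  proof (rule poly_XYZT_induct[where S = "\<lambda>p. theta p \<in> range omega"])
    show "theta Y4 \<in> range omega"
      using theta3_in_range_omega[of "[:0, 1:]"] theta_emb_XYZ[of "[:0, 1:]"]
      by (simp add: emb_XYZ_def Y4_def)
  qed (auto intro: range_omega_add range_omega_mult theta_emb_XZ_in_range_omega
      theta_T4_in_range_omega)
  then show ?thesis using range_omega by blast
qed

end

section \<open>The quotient ring \<open>B\<close> and the passage from cosets to
  representatives\<close>

lemma ring_XYZT_simps [simp]:
  "carrier ring_XYZT = UNIV" "p \<otimes>\<^bsub>ring_XYZT\<^esub> q = p * q" "p \<oplus>\<^bsub>ring_XYZT\<^esub> q = p + q"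
  "\<one>\<^bsub>ring_XYZT\<^esub> = 1" "\<zero>\<^bsub>ring_XYZT\<^esub> = 0"
  by (simp_all add: ring_XYZT_def ring_of_type_algebra_def)

lemma cring_ring_XYZT: "cring ring_XYZT"
  unfolding ring_XYZT_def by (rule cring_from_type_algebra)

interpretation XYZT: cring ring_XYZT by (rule cring_ring_XYZT)

lemma ring_XYZT_a_inv [simp]: "\<ominus>\<^bsub>ring_XYZT\<^esub> p = - p"
  by (rule XYZT.minus_equality) simp_all

lemma ring_XYZT_minus [simp]: "p \<ominus>\<^bsub>ring_XYZT\<^esub> q = p - q"
  by (simp add: a_minus_def)

lemma genideal_pair_ring_XYZT: "Idl\<^bsub>ring_XYZT\<^esub> {f, g} = ideal2 f g"
proof
  have "ideal (ideal2 f g) ring_XYZT"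
  proof (rule idealI[OF XYZT.ring_axioms])
    show "subgroup (ideal2 f g) (add_monoid ring_XYZT)"
      by (rule XYZT.add.subgroupI)
        (auto intro: ideal2_add ideal2_zero ideal2_uminus simp: a_inv_def[symmetric])
    show "q \<otimes>\<^bsub>ring_XYZT\<^esub> p \<in> ideal2 f g" "p \<otimes>\<^bsub>ring_XYZT\<^esub> q \<in> ideal2 f g" if "p \<in> ideal2 f g" for p q
      using ideal2_mult[OF that, of q] by (simp_all add: mult.commute)
  qed
  then show "Idl\<^bsub>ring_XYZT\<^esub> {f, g} \<subseteq> ideal2 f g"
    by (rule XYZT.genideal_minimal) (simp add: ideal2_gen)
  interpret I: ideal "Idl\<^bsub>ring_XYZT\<^esub> {f, g}" ring_XYZT
    by (rule XYZT.genideal_ideal) simp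
  have fg: "{f, g} \<subseteq> Idl\<^bsub>ring_XYZT\<^esub> {f, g}"
    by (rule XYZT.genideal_self) simp
  show "ideal2 f g \<subseteq> Idl\<^bsub>ring_XYZT\<^esub> {f, g}"
  proof
    fix p assume "p \<in> ideal2 f g"
    then obtain a b where "p = a * f + b * g" by (rule ideal2E)
    moreover have "a * f \<in> Idl\<^bsub>ring_XYZT\<^esub> {f, g}" "b * g \<in> Idl\<^bsub>ring_XYZT\<^esub> {f, g}"
      using fg I.I_l_closed[of f a] I.I_l_closed[of g b] by auto
    ultimately show "p \<in> Idl\<^bsub>ring_XYZT\<^esub> {f, g}"
      using I.a_closed[of "a * f" "b * g"] by simp
  qed
qed

context threefold
begin

lemma B_ideal_eq: "B_ideal d e P Q = J"
  unfolding B_ideal_def J_def by (rule genideal_pair_ring_XYZT)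

lemma ideal_B_ideal: "ideal (B_ideal d e P Q) ring_XYZT"
  unfolding B_ideal_def by (rule XYZT.genideal_ideal) simp

sublocale B: ideal "B_ideal d e P Q" "ring_XYZT :: 'k poly_XYZT ring"
  by (rule ideal_B_ideal)

text \<open>The kernel of \<open>theta\<close> is the defining ideal, so \<open>theta\<close>
  induces an embedding of \<open>B\<close>, and equations between cosets can be checked in the field
  of fractions.\<close>

lemma B_class_eq_iff: "B_class d e P Q p = B_class d e P Q q \<longleftrightarrow> theta p = theta q"
proof -
  have "B_class d e P Q p = B_class d e P Q q \<longleftrightarrow> p - q \<in> J"
    using XYZT.quotient_eq_iff_same_a_r_cos[OF ideal_B_ideal, of p q]
    by (auto simp: B_class_def B_ideal_eq)
  also have "\<dots> \<longleftrightarrow> theta p = theta q" by (simp flip: theta_eq_0_iff)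
  finally show ?thesis .
qed

lemma B_class_ring_hom: "B_class d e P Q \<in> ring_hom ring_XYZT (B_ring d e P Q)"
  using B.rcos_ring_hom unfolding B_ring_def B_class_def .

lemma B_class_add:
  "B_class d e P Q (p + q) = B_class d e P Q p \<oplus>\<^bsub>B_ring d e P Q\<^esub> B_class d e P Q q"
  using ring_hom_add[OF B_class_ring_hom, of p q] by simp

lemma B_class_mult:
  "B_class d e P Q (p * q) = B_class d e P Q p \<otimes>\<^bsub>B_ring d e P Q\<^esub> B_class d e P Q q"
  using ring_hom_mult[OF B_class_ring_hom, of p q] by simp

lemma B_class_one: "B_class d e P Q 1 = \<one>\<^bsub>B_ring d e P Q\<^esub>"
  using ring_hom_one[OF B_class_ring_hom] by simp

lemma carrier_B_ring: "carrier (B_ring d e P Q) = range (B_class d e P Q)"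
  by (auto simp: B_ring_def FactRing_def A_RCOSETS_def' B_class_def)

lemma ring_B_ring: "ring (B_ring d e P Q)"
  unfolding B_ring_def by (rule B.quotient_is_ring)

lemma B_class_uminus: "B_class d e P Q (- p) = \<ominus>\<^bsub>B_ring d e P Q\<^esub> B_class d e P Q p"
proof -
  interpret h: ring_hom_ring ring_XYZT "B_ring d e P Q" "B_class d e P Q"
    by (intro ring_hom_ringI2 XYZT.ring_axioms ring_B_ring B_class_ring_hom)
  show ?thesis using h.hom_a_inv[of p] by simp
qed

text \<open>Supplies polynomial representatives in \<open>X\<close> and \<open>Z\<close>: the cosets
  having one contain the generators and are closed under the ring operations.\<close>

lemma B_kxz_subset: "B_kxz d e P Q \<subseteq> (\<lambda>r. B_class d e P Q (emb_XZ r)) ` UNIV"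
proof
  fix b assume "b \<in> B_kxz d e P Q"
  then show "b \<in> (\<lambda>r. B_class d e P Q (emb_XZ r)) ` UNIV"
    unfolding B_kxz_def
  proof (induction rule: generate_ring.induct)
    case one
    show ?case by (rule image_eqI[of _ _ 1]) (simp_all add: B_class_one)
  next
    case (incl b)
    have "const4 c = emb_XZ [:[:c:]:]" "X4 = emb_XZ X2" "Z4 = emb_XZ [:0, 1:]" for c :: 'k
      by (simp_all add: const4_def X4_def Z4_def emb_XZ_def)
    then have "B_class d e P Q (const4 c) \<in> range (\<lambda>r. B_class d e P Q (emb_XZ r))"
      "B_class d e P Q X4 \<in> range (\<lambda>r. B_class d e P Q (emb_XZ r))"
      "B_class d e P Q Z4 \<in> range (\<lambda>r. B_class d e P Q (emb_XZ r))" for c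
      by (metis rangeI)+
    then show ?case
      using incl by (elim UnE rangeE insertE) (simp_all add: B_const_def B_x_def B_z_def)
  next
    case (a_inv b)
    then show ?case by (auto simp flip: B_class_uminus emb_XZ.hom_uminus)
  next
    case (eng_add a b)
    then show ?case by (auto simp flip: B_class_add emb_XZ.hom_add)
  next
    case (eng_mult a b)
    then show ?case by (auto simp flip: B_class_mult emb_XZ.hom_mult)
  qed
qed

end

theorem theorem3p13:
  fixes d e r s :: nat
    and P :: "'k::field poly_XZ"
    and Q :: "'k poly_XYZ"
    and \<psi> :: "'k poly_XYZT set \<Rightarrow> 'k poly_XYZT set"
    and lam :: 'k
  assumes "d \<ge> 1" and "e \<ge> 1"
    and "lead_coeff P = 1" and "r = Polynomial.degree P"
    and "lead_coeff Q = 1" and "s = Polynomial.degree Q"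
    and "(r \<ge> 2 \<and> s \<ge> 2) \<or> (r \<ge> 2 \<and> s = 1) \<or> (r = 1 \<and> s \<ge> 2 \<and> e \<ge> 2)"
    and "B_alg_endo d e P Q \<psi>"
    and "\<psi> ` B_kxz d e P Q = B_kxz d e P Q"
    and "lam \<noteq> 0"
    and "\<psi> (B_x d e P Q) = B_const d e P Q lam \<otimes>\<^bsub>B_ring d e P Q\<^esub> B_x d e P Q"
  shows "\<psi> \<in> ring_iso (B_ring d e P Q) (B_ring d e P Q)"
proof -
  interpret threefold d e P Q
    using assms(1-7) by unfold_locales auto
  let ?B = "B_ring d e P Q" and ?cl = "B_class d e P Q"
  have hom: "\<psi> \<in> ring_hom ?B ?B" and const: "\<psi> (?cl (const4 c)) = ?cl (const4 c)" for c
    using assms(8) by (auto simp: B_alg_endo_def B_const_def)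
  have cl: "?cl p \<in> carrier ?B" for p by (simp add: carrier_B_ring)
  \<comment> \<open>The choice of representative is immaterial after applying \<open>theta\<close>,
    which is why \<open>omega\<close> below is additive and multiplicative although
    \<open>rep\<close> need not be.\<close>
  define rep where "rep p = (SOME q. ?cl q = \<psi> (?cl p))" for p
  have rep: "?cl (rep p) = \<psi> (?cl p)" for p
  proof -
    have "\<psi> (?cl p) \<in> range ?cl"
      using ring_hom_closed[OF hom cl] by (simp add: carrier_B_ring)
    then have "\<exists>q. ?cl q = \<psi> (?cl p)" by (auto simp: image_iff)
    then show ?thesis unfolding rep_def by (rule someI_ex)
  qed
  define omega where "omega p = theta (rep p)" for p
  have omegaI: "omega p = theta q" if "\<psi> (?cl p) = ?cl q" for p q
    using that by (simp add: omega_def rep flip: B_class_eq_iff)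
  \<comment> \<open>One inclusion of \<open>\<psi>(k[x, z]) = k[x, z]\<close> yields
    \<open>h\<close> from the image of \<open>z\<close>; the other yields \<open>p\<close> from a
    preimage of \<open>z\<close>.\<close>
  have Z: "?cl Z4 \<in> B_kxz d e P Q"
    unfolding B_kxz_def by (rule generate_ring.incl) (simp add: B_z_def)
  then have "\<psi> (?cl Z4) \<in> B_kxz d e P Q" using assms(9) by blast
  then obtain h where h: "\<psi> (?cl Z4) = ?cl (emb_XZ h)" using B_kxz_subset by blast
  have "?cl Z4 \<in> \<psi> ` B_kxz d e P Q" using Z assms(9) by simp
  then obtain p where p: "?cl Z4 = \<psi> (?cl (emb_XZ p))" using B_kxz_subset by blast
  interpret threefold_endo d e P Q omega lam h p
  proof
    show "omega 1 = 1"
      using omegaI[of 1 1] ring_hom_one[OF hom] by (simp add: B_class_one)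
    show "omega (a + b) = omega a + omega b" for a b
      using omegaI[of "a + b" "rep a + rep b"] ring_hom_add[OF hom cl cl, of a b]
      by (simp add: B_class_add rep omega_def)
    show "omega (a * b) = omega a * omega b" for a b
      using omegaI[of "a * b" "rep a * rep b"] ring_hom_mult[OF hom cl cl, of a b]
      by (simp add: B_class_mult rep omega_def)
    show "range omega \<subseteq> range theta" by (auto simp: omega_def)
    show "omega (const4 c) = theta (const4 c)" for c by (rule omegaI[OF const])
    show "omega X4 = theta (const4 lam * X4)"
      by (rule omegaI) (use assms(11) in \<open>simp only: B_class_mult B_x_def B_const_def\<close>)
    show "lam \<noteq> 0" by fact
    show "omega Z4 = theta (emb_XZ h)" by (rule omegaI[OF h])
    show "theta Z4 = omega (emb_XZ p)" by (rule omegaI[symmetric]) (simp add: p)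
    show "omega q = 0" if "theta q = 0" for q
    proof -
      have "?cl q = ?cl 0" using that by (simp add: B_class_eq_iff)
      moreover have "?cl 0 = ?cl (const4 0)" by (simp add: const4_def)
      ultimately have "\<psi> (?cl q) = ?cl 0" using const[of 0] by simp
      then show ?thesis using omegaI[of q 0] by simp
    qed
  qed
  have "inj_on \<psi> (carrier ?B)"
  proof (rule inj_onI)
    fix a b assume "a \<in> carrier ?B" "b \<in> carrier ?B" and eq: "\<psi> a = \<psi> b"
    then obtain q q' where q: "a = ?cl q" "b = ?cl q'" by (auto simp: carrier_B_ring)
    have "omega q = omega q'"
      using eq omegaI[of q "rep q'"] by (simp add: q rep omega_def)
    then have "omega (q - q') = 0" by simp
    then have "theta (q - q') = 0" by (rule omega_eq_0_imp)
    then show "a = b" by (simp add: q B_class_eq_iff)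
  qed
  moreover have "\<psi> ` carrier ?B = carrier ?B"
  proof
    show "\<psi> ` carrier ?B \<subseteq> carrier ?B" using ring_hom_closed[OF hom] by blast
    show "carrier ?B \<subseteq> \<psi> ` carrier ?B"
    proof
      fix a assume "a \<in> carrier ?B"
      then obtain q where q: "a = ?cl q" by (auto simp: carrier_B_ring)
      have "theta q \<in> range omega" by (simp add: range_omega_eq)
      then obtain q' where "theta q = omega q'" by blast
      then have "a = \<psi> (?cl q')" by (simp add: q omega_def B_class_eq_iff flip: rep)
      then show "a \<in> \<psi> ` carrier ?B" using cl by blast
    qed
  qed
  ultimately show ?thesis using hom by (simp add: ring_iso_def bij_betw_def)
qed

end
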